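(* Let $f\colon [0,\infty)\to (0,\infty)$ be a non-decreasing function such that $\sum_{n=1}^{\infty} \frac{1}{f(2^n)}<\infty$. Let $0<r<1\leq p$, and let $\{X_n\}_{n\geq 1}$ be a sequence of (1) pairwise negatively quadrant dependent random variables if $1\leq p<2$, (2) negatively associated random variables if $p\geq 2$. Assume that $\sup_{n\geq 1} \mathbb{E}(|X_n|^pf(|X_n|))<\infty$. Then for all $\varepsilon>0$ we have $$\sum_{n=1}^{\infty} n^{p/r-2}\, \mathbb{P}(M_n>\varepsilon n^{1/r})<\infty.$$
   Context: All random variables are real-valued and those in a sequence $\{X_n\}_{n\geq 1}$ are defined on the same probability space. The variables are not assumed to be centered. For $n\geq 1$ let $S_n=\sum_{i=1}^n X_i$ and $M_n=\max_{1\leq i\leq n}|S_i|$. Two random variables $X$ and $Y$ are negatively quadrant dependent (NQD) if for all $x,y\in\mathbb{R}$ we have $\mathbb{P}(X\leq x,\, Y\leq y)\leq \mathbb{P}(X\leq x)\,\mathbb{P}(Y\leq y)$. A sequence is pairwise NQD if $X_i$ and $X_j$ are NQD for all $i\neq j$. A finite family $\{X_i: 1\leq i\leq n\}$ is negatively associated if for every pair of disjoint subsets $A_1,A_2\subset\{1,\dots,n\}$ we have $\mathrm{Cov}(f_1(X_i: i\in A_1),\, f_2(X_j: j\in A_2))\leq 0$ for all coordinatewise non-decreasing functions $f_1,f_2$ for which the covariance exists. An infinite family is negatively associated if every finite subfamily is. *)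

theory Defs
  imports "HOL-Probability.Probability"
begin

definition NQD :: "'a measure \<Rightarrow> ('a \<Rightarrow> real) \<Rightarrow> ('a \<Rightarrow> real) \<Rightarrow> bool" where
  "NQD M X Y \<longleftrightarrow>
     (\<forall>x y. measure M {\<omega> \<in> space M. X \<omega> \<le> x \<and> Y \<omega> \<le> y}
          \<le> measure M {\<omega> \<in> space M. X \<omega> \<le> x} * measure M {\<omega> \<in> space M. Y \<omega> \<le> y})"

definition pairwise_NQD :: "'a measure \<Rightarrow> 'i set \<Rightarrow> ('i \<Rightarrow> 'a \<Rightarrow> real) \<Rightarrow> bool" where
  "pairwise_NQD M I X \<longleftrightarrow> pairwise (\<lambda>i j. NQD M (X i) (X j)) I"

definition covariance :: "'a measure \<Rightarrow> ('a \<Rightarrow> real) \<Rightarrow> ('a \<Rightarrow> real) \<Rightarrow> real" where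
  "covariance M U V =
     (\<integral>\<omega>. (U \<omega> - (\<integral>\<omega>'. U \<omega>' \<partial>M)) * (V \<omega> - (\<integral>\<omega>'. V \<omega>' \<partial>M)) \<partial>M)"

definition covariance_exists :: "'a measure \<Rightarrow> ('a \<Rightarrow> real) \<Rightarrow> ('a \<Rightarrow> real) \<Rightarrow> bool" where
  "covariance_exists M U V \<longleftrightarrow>
     integrable M U \<and> integrable M V \<and> integrable M (\<lambda>\<omega>. U \<omega> * V \<omega>)"

text \<open>
  A function on the product of copies of the real line indexed by \<open>A\<close> is represented by its
  values on \<open>extensional A\<close>, where the pointwise order compares exactly the coordinates
  in \<open>A\<close>; so \<open>mono_on (extensional A)\<close> says coordinatewise non-decreasing.
  The functions themselves need not be Borel: \<open>covariance_exists\<close> already makes their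
  compositions with the family measurable.
\<close>

definition negatively_associated_finite ::
    "'a measure \<Rightarrow> 'i set \<Rightarrow> ('i \<Rightarrow> 'a \<Rightarrow> real) \<Rightarrow> bool" where
  "negatively_associated_finite M J X \<longleftrightarrow>
     (\<forall>A\<^sub>1 A\<^sub>2. \<forall>f\<^sub>1 f\<^sub>2 :: ('i \<Rightarrow> real) \<Rightarrow> real.
        A\<^sub>1 \<subseteq> J \<longrightarrow> A\<^sub>2 \<subseteq> J \<longrightarrow> A\<^sub>1 \<inter> A\<^sub>2 = {} \<longrightarrow>
        mono_on (extensional A\<^sub>1) f\<^sub>1 \<longrightarrow> mono_on (extensional A\<^sub>2) f\<^sub>2 \<longrightarrow>
        covariance_exists M (\<lambda>\<omega>. f\<^sub>1 (\<lambda>i\<in>A\<^sub>1. X i \<omega>)) (\<lambda>\<omega>. f\<^sub>2 (\<lambda>j\<in>A\<^sub>2. X j \<omega>)) \<longrightarrow>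
        covariance M (\<lambda>\<omega>. f\<^sub>1 (\<lambda>i\<in>A\<^sub>1. X i \<omega>)) (\<lambda>\<omega>. f\<^sub>2 (\<lambda>j\<in>A\<^sub>2. X j \<omega>)) \<le> 0)"

definition negatively_associated ::
    "'a measure \<Rightarrow> 'i set \<Rightarrow> ('i \<Rightarrow> 'a \<Rightarrow> real) \<Rightarrow> bool" where
  "negatively_associated M I X \<longleftrightarrow>
     (\<forall>J. finite J \<longrightarrow> J \<subseteq> I \<longrightarrow> negatively_associated_finite M J X)"

definition partial_sum :: "(nat \<Rightarrow> 'a \<Rightarrow> real) \<Rightarrow> nat \<Rightarrow> 'a \<Rightarrow> real" where
  "partial_sum X n \<omega> = (\<Sum>i=1..n. X i \<omega>)"

text \<open>Only meaningful for \<open>n \<ge> 1\<close>; for \<open>n = 0\<close> this is the maximum of the empty set.\<close>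

definition max_partial_sum :: "(nat \<Rightarrow> 'a \<Rightarrow> real) \<Rightarrow> nat \<Rightarrow> 'a \<Rightarrow> real" where
  "max_partial_sum X n \<omega> = Max ((\<lambda>i. \<bar>partial_sum X i \<omega>\<bar>) ` {1..n})"

end

theory Submission
  imports Defs
begin

text \<open>
  Since \<open>r < 1\<close>, the threshold \<open>\<epsilon> * n powr (1 / r)\<close> dominates the means of the sums, which are
  \<open>O(n)\<close>. So nothing is lost by bounding the maximum by the sum of the positive parts plus the sum of
  the negative parts. These sums are monotone in \<open>n\<close>: no maximal inequality is needed, and it
  suffices to consider \<open>n = 2 ^ m\<close>. Each of the two sums is truncated at a multiple of
  \<open>c ^ m\<close>, where \<open>c = 2 powr (1 / r) > 2\<close>; the probability of exceeding the truncation level is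
  controlled by Markov's inequality. The truncated sum is handled by Chebyshev's inequality
  in the pairwise NQD case and by a Chernoff bound in the negatively associated case.
\<close>

context prob_space
begin

lemma NQD_iff_survival:
  assumes [measurable]: "X \<in> borel_measurable M" "Y \<in> borel_measurable M"
  shows "NQD M X Y \<longleftrightarrow>
    (\<forall>x y. prob {\<omega>\<in>space M. x < X \<omega> \<and> y < Y \<omega>} \<le>
       prob {\<omega>\<in>space M. x < X \<omega>} * prob {\<omega>\<in>space M. y < Y \<omega>})"
proof -
  have "prob {\<omega>\<in>space M. X \<omega> \<le> x \<and> Y \<omega> \<le> y} - prob {\<omega>\<in>space M. X \<omega> \<le> x} * prob {\<omega>\<in>space M. Y \<omega> \<le> y}
      = prob {\<omega>\<in>space M. x < X \<omega> \<and> y < Y \<omega>} - prob {\<omega>\<in>space M. x < X \<omega>} * prob {\<omega>\<in>space M. y < Y \<omega>}"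
    for x y
  proof -
    let ?A = "{\<omega>\<in>space M. X \<omega> \<le> x}" and ?B = "{\<omega>\<in>space M. Y \<omega> \<le> y}"
    have "prob (?A \<union> ?B) = prob ?A + prob ?B - prob (?A \<inter> ?B)"
      by (intro measure_Un3) (auto simp: fmeasurable_eq_sets)
    moreover have "prob (space M - (?A \<union> ?B)) = 1 - prob (?A \<union> ?B)"
      by (intro prob_compl) measurable
    moreover have "space M - (?A \<union> ?B) = {\<omega>\<in>space M. x < X \<omega> \<and> y < Y \<omega>}"
      "?A \<inter> ?B = {\<omega>\<in>space M. X \<omega> \<le> x \<and> Y \<omega> \<le> y}"
      by auto
    ultimately have "prob {\<omega>\<in>space M. x < X \<omega> \<and> y < Y \<omega>} =
        1 - prob ?A - prob ?B + prob {\<omega>\<in>space M. X \<omega> \<le> x \<and> Y \<omega> \<le> y}"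
      by simp
    moreover have "prob {\<omega>\<in>space M. x < X \<omega>} = 1 - prob ?A"
      by (subst prob_neg[symmetric]) (auto simp: not_le)
    moreover have "prob {\<omega>\<in>space M. y < Y \<omega>} = 1 - prob ?B"
      by (subst prob_neg[symmetric]) (auto simp: not_le)
    moreover have "w - u * v = q - a * b"
      if "q = 1 - u - v + w" "a = 1 - u" "b = 1 - v" for a b u v w q :: real
      unfolding that by (simp add: algebra_simps)
    ultimately show ?thesis
      by blast
  qed
  from this[THEN arg_cong[where f = "\<lambda>d. d \<le> 0"]] show ?thesis
    unfolding NQD_def diff_le_0_iff_le by simp
qed

lemma NQD_uminus:
  assumes [measurable]: "X \<in> borel_measurable M" "Y \<in> borel_measurable M" and "NQD M X Y"
  shows "NQD M (\<lambda>\<omega>. - X \<omega>) (\<lambda>\<omega>. - Y \<omega>)"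
proof -
  have lim: "(\<lambda>n. prob {\<omega>\<in>space M. U \<omega> \<le> x - 1 / Suc n \<and> V \<omega> \<le> y - 1 / Suc n})
      \<longlonglongrightarrow> prob {\<omega>\<in>space M. U \<omega> < x \<and> V \<omega> < y}"
    if [measurable]: "U \<in> borel_measurable M" "V \<in> borel_measurable M" for U V and x y :: real
  proof -
    let ?A = "\<lambda>n. {\<omega>\<in>space M. U \<omega> \<le> x - 1 / Suc n \<and> V \<omega> \<le> y - 1 / Suc n}"
    have "incseq ?A"
      by (intro monoI) (auto elim!: order_trans intro!: divide_left_mono)
    then have "(\<lambda>n. prob (?A n)) \<longlonglongrightarrow> prob (\<Union>n. ?A n)"
      by (intro finite_Lim_measure_incseq) auto
    moreover have "(\<Union>n. ?A n) = {\<omega>\<in>space M. U \<omega> < x \<and> V \<omega> < y}"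
    proof safe
      fix \<omega> assume \<omega>: "\<omega> \<in> space M" "U \<omega> < x" "V \<omega> < y"
      then obtain n where "inverse (Suc n) < min (x - U \<omega>) (y - V \<omega>)"
        using reals_Archimedean[of "min (x - U \<omega>) (y - V \<omega>)"] by auto
      then have "\<omega> \<in> ?A n"
        using \<omega> by (auto simp: inverse_eq_divide)
      then show "\<omega> \<in> (\<Union>n. ?A n)"
        by blast
    qed (auto elim!: order.strict_trans1)
    ultimately show ?thesis by simp
  qed
  have "prob {\<omega>\<in>space M. X \<omega> < x \<and> Y \<omega> < y} \<le> prob {\<omega>\<in>space M. X \<omega> < x} * prob {\<omega>\<in>space M. Y \<omega> < y}"
    for x y
  proof (rule LIMSEQ_le)
    show "(\<lambda>n. prob {\<omega>\<in>space M. X \<omega> \<le> x - 1 / Suc n} * prob {\<omega>\<in>space M. Y \<omega> \<le> y - 1 / Suc n})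
      \<longlonglongrightarrow> prob {\<omega>\<in>space M. X \<omega> < x} * prob {\<omega>\<in>space M. Y \<omega> < y}"
      using lim[of X X x x] lim[of Y Y y y] by (intro tendsto_mult) simp_all
    show "(\<lambda>n. prob {\<omega>\<in>space M. X \<omega> \<le> x - 1 / Suc n \<and> Y \<omega> \<le> y - 1 / Suc n})
      \<longlonglongrightarrow> prob {\<omega>\<in>space M. X \<omega> < x \<and> Y \<omega> < y}"
      by (rule lim) auto
  qed (use assms(3) in \<open>auto simp: NQD_def\<close>)
  then have "prob {\<omega>\<in>space M. x < - X \<omega> \<and> y < - Y \<omega>} \<le>
       prob {\<omega>\<in>space M. x < - X \<omega>} * prob {\<omega>\<in>space M. y < - Y \<omega>}" for x y
    by (simp add: less_minus_iff[of x] less_minus_iff[of y])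
  then show ?thesis
    by (simp add: NQD_iff_survival)
qed

lemma NQD_clamp:
  assumes "NQD M X Y" and "0 \<le> b"
  shows "NQD M (\<lambda>\<omega>. min b (max 0 (X \<omega>))) (\<lambda>\<omega>. min b (max 0 (Y \<omega>)))"
  unfolding NQD_def
proof (intro allI)
  fix x y :: real
  consider "x < 0 \<or> y < 0" | "b \<le> x" "0 \<le> y" | "b \<le> y" "0 \<le> x" | "0 \<le> x" "x < b" "0 \<le> y" "y < b"
    by linarith
  then show "prob {\<omega> \<in> space M. min b (max 0 (X \<omega>)) \<le> x \<and> min b (max 0 (Y \<omega>)) \<le> y}
      \<le> prob {\<omega> \<in> space M. min b (max 0 (X \<omega>)) \<le> x} * prob {\<omega> \<in> space M. min b (max 0 (Y \<omega>)) \<le> y}"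
  proof cases
    case 1
    then have "{\<omega> \<in> space M. min b (max 0 (X \<omega>)) \<le> x \<and> min b (max 0 (Y \<omega>)) \<le> y} = {}"
      using assms(2) by auto
    then show ?thesis by (simp only:) simp
  next
    case 2
    then show ?thesis by (simp add: min.coboundedI1 prob_space)
  next
    case 3
    then show ?thesis by (simp add: min.coboundedI1 prob_space)
  next
    case 4
    then have "min b (max 0 z) \<le> x \<longleftrightarrow> z \<le> x" "min b (max 0 z) \<le> y \<longleftrightarrow> z \<le> y" for z
      by auto
    then show ?thesis
      using assms(1) by (simp add: NQD_def)
  qed
qed

text \<open>Hoeffding's covariance formula, by writing each factor as an integral over its levels.\<close>

lemma NQD_nn_integral_mult_le:
  assumes [measurable]: "X \<in> borel_measurable M" "Y \<in> borel_measurable M"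
    and "NQD M X Y" "\<And>\<omega>. 0 \<le> X \<omega>" "\<And>\<omega>. 0 \<le> Y \<omega>"
  shows "(\<integral>\<^sup>+\<omega>. ennreal (X \<omega> * Y \<omega>) \<partial>M) \<le> (\<integral>\<^sup>+\<omega>. ennreal (X \<omega>) \<partial>M) * (\<integral>\<^sup>+\<omega>. ennreal (Y \<omega>) \<partial>M)"
proof -
  interpret L: pair_sigma_finite M lborel ..
  define l :: "real \<Rightarrow> real \<Rightarrow> ennreal" where "l x u = (if 0 \<le> x \<and> x < u then 1 else 0)" for x u
  have level: "ennreal u = (\<integral>\<^sup>+x. l x u \<partial>lborel)" if "0 \<le> u" for u
  proof -
    have "(\<integral>\<^sup>+x. l x u \<partial>lborel) = (\<integral>\<^sup>+x. indicator {0..<u} x \<partial>lborel)"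
      by (intro nn_integral_cong) (auto simp: l_def)
    then show ?thesis using that by simp
  qed
  have E: "(\<integral>\<^sup>+\<omega>. l x (U \<omega>) \<partial>M) = (if 0 \<le> x then ennreal (prob {\<omega>\<in>space M. x < U \<omega>}) else 0)"
    if [measurable]: "U \<in> borel_measurable M" for U x
  proof -
    have "(\<integral>\<^sup>+\<omega>. l x (U \<omega>) \<partial>M) = (\<integral>\<^sup>+\<omega>. (if 0 \<le> x then indicator {\<omega>\<in>space M. x < U \<omega>} \<omega> else 0) \<partial>M)"
      by (intro nn_integral_cong) (auto simp: l_def)
    then show ?thesis by (simp add: emeasure_eq_measure)
  qed
  have E2: "(\<integral>\<^sup>+\<omega>. l x (X \<omega>) * l y (Y \<omega>) \<partial>M) \<le> (\<integral>\<^sup>+\<omega>. l x (X \<omega>) \<partial>M) * (\<integral>\<^sup>+\<omega>. l y (Y \<omega>) \<partial>M)" for x y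
  proof (cases "0 \<le> x \<and> 0 \<le> y")
    case True
    have "(\<integral>\<^sup>+\<omega>. l x (X \<omega>) * l y (Y \<omega>) \<partial>M) =
        (\<integral>\<^sup>+\<omega>. indicator {\<omega>\<in>space M. x < X \<omega> \<and> y < Y \<omega>} \<omega> \<partial>M)"
      using True by (intro nn_integral_cong) (auto simp: l_def)
    also have "\<dots> = ennreal (prob {\<omega>\<in>space M. x < X \<omega> \<and> y < Y \<omega>})"
      by (simp add: emeasure_eq_measure)
    also have "\<dots> \<le> ennreal (prob {\<omega>\<in>space M. x < X \<omega>} * prob {\<omega>\<in>space M. y < Y \<omega>})"
      using assms(3) by (intro ennreal_leI) (simp add: NQD_iff_survival)
    finally show ?thesis
      using True by (simp add: E ennreal_mult)
  qed (auto simp: l_def)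
  have "(\<integral>\<^sup>+\<omega>. ennreal (X \<omega> * Y \<omega>) \<partial>M) = (\<integral>\<^sup>+\<omega>. \<integral>\<^sup>+x. l x (X \<omega>) * ennreal (Y \<omega>) \<partial>lborel \<partial>M)"
  proof (rule nn_integral_cong)
    fix \<omega>
    have "(\<integral>\<^sup>+x. l x (X \<omega>) * ennreal (Y \<omega>) \<partial>lborel) = (\<integral>\<^sup>+x. l x (X \<omega>) \<partial>lborel) * ennreal (Y \<omega>)"
      by (rule nn_integral_multc) (unfold l_def, measurable)
    then show "ennreal (X \<omega> * Y \<omega>) = (\<integral>\<^sup>+x. l x (X \<omega>) * ennreal (Y \<omega>) \<partial>lborel)"
      using assms(4,5) by (simp add: ennreal_mult flip: level)
  qed
  also have "\<dots> = (\<integral>\<^sup>+x. \<integral>\<^sup>+\<omega>. l x (X \<omega>) * ennreal (Y \<omega>) \<partial>M \<partial>lborel)"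
    by (rule L.Fubini'[symmetric]) (unfold l_def, measurable)
  also have "\<dots> = (\<integral>\<^sup>+x. \<integral>\<^sup>+\<omega>. \<integral>\<^sup>+y. l x (X \<omega>) * l y (Y \<omega>) \<partial>lborel \<partial>M \<partial>lborel)"
  proof (intro nn_integral_cong)
    fix x \<omega>
    have "(\<integral>\<^sup>+y. l x (X \<omega>) * l y (Y \<omega>) \<partial>lborel) = l x (X \<omega>) * (\<integral>\<^sup>+y. l y (Y \<omega>) \<partial>lborel)"
      by (rule nn_integral_cmult) (unfold l_def, measurable)
    then show "l x (X \<omega>) * ennreal (Y \<omega>) = (\<integral>\<^sup>+y. l x (X \<omega>) * l y (Y \<omega>) \<partial>lborel)"
      using assms(5) by (simp flip: level)
  qed
  also have "\<dots> = (\<integral>\<^sup>+x. \<integral>\<^sup>+y. \<integral>\<^sup>+\<omega>. l x (X \<omega>) * l y (Y \<omega>) \<partial>M \<partial>lborel \<partial>lborel)"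
    by (intro nn_integral_cong L.Fubini'[symmetric]) (unfold l_def, measurable)
  also have "\<dots> \<le> (\<integral>\<^sup>+x. \<integral>\<^sup>+y. (\<integral>\<^sup>+\<omega>. l x (X \<omega>) \<partial>M) * (\<integral>\<^sup>+\<omega>. l y (Y \<omega>) \<partial>M) \<partial>lborel \<partial>lborel)"
    by (intro nn_integral_mono E2)
  also have "\<dots> = (\<integral>\<^sup>+x. (\<integral>\<^sup>+\<omega>. l x (X \<omega>) \<partial>M) * (\<integral>\<^sup>+y. \<integral>\<^sup>+\<omega>. l y (Y \<omega>) \<partial>M \<partial>lborel) \<partial>lborel)"
    by (intro nn_integral_cong nn_integral_cmult) (unfold l_def, measurable)
  also have "\<dots> = (\<integral>\<^sup>+x. \<integral>\<^sup>+\<omega>. l x (X \<omega>) \<partial>M \<partial>lborel) * (\<integral>\<^sup>+y. \<integral>\<^sup>+\<omega>. l y (Y \<omega>) \<partial>M \<partial>lborel)"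
    by (intro nn_integral_multc) (unfold l_def, measurable)
  also have "\<dots> = (\<integral>\<^sup>+\<omega>. \<integral>\<^sup>+x. l x (X \<omega>) \<partial>lborel \<partial>M) * (\<integral>\<^sup>+\<omega>. \<integral>\<^sup>+y. l y (Y \<omega>) \<partial>lborel \<partial>M)"
    by (intro arg_cong2[where f = "(*)"] L.Fubini') (unfold l_def, measurable)
  finally show ?thesis
    using assms(4,5) by (simp flip: level)
qed

lemma prob_sum_deviation_le:
  fixes Y :: "'i \<Rightarrow> 'a \<Rightarrow> real"
  assumes J: "finite J" and meas [measurable]: "\<And>i. i \<in> J \<Longrightarrow> Y i \<in> borel_measurable M"
    and nonneg: "\<And>i \<omega>. i \<in> J \<Longrightarrow> 0 \<le> Y i \<omega>" and bound: "\<And>i \<omega>. i \<in> J \<Longrightarrow> Y i \<omega> \<le> b"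
    and nqd: "pairwise_NQD M J Y"
    and "0 < a"
  shows "prob {\<omega>\<in>space M. a \<le> (\<Sum>i\<in>J. Y i \<omega>) - (\<Sum>i\<in>J. expectation (Y i))}
    \<le> (\<Sum>i\<in>J. expectation (\<lambda>\<omega>. (Y i \<omega>)\<^sup>2)) / a\<^sup>2"
proof -
  let ?S = "\<lambda>\<omega>. \<Sum>i\<in>J. Y i \<omega>"
  have int: "integrable M (Y i)" if "i \<in> J" for i
    using that nonneg bound by (intro integrable_const_bound[where B = b] AE_I2) auto
  have int2: "integrable M (\<lambda>\<omega>. Y i \<omega> * Y j \<omega>)" if "i \<in> J" "j \<in> J" for i j
    using that nonneg bound order_trans[OF nonneg bound]
    by (intro integrable_const_bound[where B = "b * b"] AE_I2) (auto simp: abs_mult intro!: mult_mono)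
  have ES: "expectation ?S = (\<Sum>i\<in>J. expectation (Y i))"
    using int by simp
  have S2: "(?S \<omega>)\<^sup>2 = (\<Sum>i\<in>J. \<Sum>j\<in>J. Y i \<omega> * Y j \<omega>)" for \<omega>
    by (simp add: power2_eq_square sum_product)
  have intS2: "integrable M (\<lambda>\<omega>. (?S \<omega>)\<^sup>2)"
    unfolding S2 using int2 by auto
  have le: "expectation (\<lambda>\<omega>. Y i \<omega> * Y j \<omega>)
      \<le> (if i = j then expectation (\<lambda>\<omega>. (Y i \<omega>)\<^sup>2) else 0) + expectation (Y i) * expectation (Y j)"
    if ij: "i \<in> J" "j \<in> J" for i j
  proof (cases "i = j")
    case False
    have "ennreal (expectation (\<lambda>\<omega>. Y i \<omega> * Y j \<omega>)) = (\<integral>\<^sup>+\<omega>. ennreal (Y i \<omega> * Y j \<omega>) \<partial>M)"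
      using ij int2 nonneg by (intro nn_integral_eq_integral[symmetric]) auto
    also have "\<dots> \<le> (\<integral>\<^sup>+\<omega>. ennreal (Y i \<omega>) \<partial>M) * (\<integral>\<^sup>+\<omega>. ennreal (Y j \<omega>) \<partial>M)"
      using False ij nqd nonneg by (intro NQD_nn_integral_mult_le) (auto simp: pairwise_NQD_def pairwise_def)
    also have "\<dots> = ennreal (expectation (Y i)) * ennreal (expectation (Y j))"
      using ij int nonneg by (simp add: nn_integral_eq_integral)
    also have "\<dots> = ennreal (expectation (Y i) * expectation (Y j))"
      using ij nonneg by (simp add: ennreal_mult)
    finally show ?thesis
      using False ij nonneg by (simp add: ennreal_le_iff)
  qed (simp add: power2_eq_square)
  have "expectation (\<lambda>\<omega>. (?S \<omega>)\<^sup>2) = (\<Sum>i\<in>J. \<Sum>j\<in>J. expectation (\<lambda>\<omega>. Y i \<omega> * Y j \<omega>))"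
    unfolding S2 using int2 by simp
  also have "\<dots> \<le> (\<Sum>i\<in>J. \<Sum>j\<in>J. (if i = j then expectation (\<lambda>\<omega>. (Y i \<omega>)\<^sup>2) else 0)
      + expectation (Y i) * expectation (Y j))"
    by (intro sum_mono le)
  also have "\<dots> = (\<Sum>i\<in>J. expectation (\<lambda>\<omega>. (Y i \<omega>)\<^sup>2)) + (expectation ?S)\<^sup>2"
    using J unfolding ES by (simp add: sum.distrib power2_eq_square sum_product)
  finally have var: "variance ?S \<le> (\<Sum>i\<in>J. expectation (\<lambda>\<omega>. (Y i \<omega>)\<^sup>2))"
    using int intS2 by (subst variance_eq) auto
  have "prob {\<omega>\<in>space M. a \<le> ?S \<omega> - (\<Sum>i\<in>J. expectation (Y i))}
      \<le> prob {\<omega>\<in>space M. a \<le> \<bar>?S \<omega> - expectation ?S\<bar>}"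
    unfolding ES by (intro finite_measure_mono) auto
  also have "\<dots> \<le> variance ?S / a\<^sup>2"
    using intS2 \<open>0 < a\<close> by (intro Chebyshev_inequality) auto
  also have "\<dots> \<le> (\<Sum>i\<in>J. expectation (\<lambda>\<omega>. (Y i \<omega>)\<^sup>2)) / a\<^sup>2"
    using var by (intro divide_right_mono) auto
  finally show ?thesis .
qed

end

lemma negatively_associated_finiteD:
  assumes "negatively_associated_finite M J X"
    and "A\<^sub>1 \<subseteq> J" "A\<^sub>2 \<subseteq> J" "A\<^sub>1 \<inter> A\<^sub>2 = {}"
    and "mono_on (extensional A\<^sub>1) f\<^sub>1" "mono_on (extensional A\<^sub>2) f\<^sub>2"
    and "covariance_exists M (\<lambda>\<omega>. f\<^sub>1 (\<lambda>i\<in>A\<^sub>1. X i \<omega>)) (\<lambda>\<omega>. f\<^sub>2 (\<lambda>j\<in>A\<^sub>2. X j \<omega>))"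
  shows "covariance M (\<lambda>\<omega>. f\<^sub>1 (\<lambda>i\<in>A\<^sub>1. X i \<omega>)) (\<lambda>\<omega>. f\<^sub>2 (\<lambda>j\<in>A\<^sub>2. X j \<omega>)) \<le> 0"
  using assms unfolding negatively_associated_finite_def by blast

lemma negatively_associated_uminus:
  fixes X :: "'i \<Rightarrow> 'a \<Rightarrow> real"
  assumes "negatively_associated M I X"
  shows "negatively_associated M I (\<lambda>i \<omega>. - X i \<omega>)"
  unfolding negatively_associated_def negatively_associated_finite_def
proof (intro allI impI)
  fix J A\<^sub>1 A\<^sub>2 and f\<^sub>1 f\<^sub>2 :: "('i \<Rightarrow> real) \<Rightarrow> real"
  assume J: "finite J" "J \<subseteq> I" and A: "A\<^sub>1 \<subseteq> J" "A\<^sub>2 \<subseteq> J" "A\<^sub>1 \<inter> A\<^sub>2 = {}"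
    and mono: "mono_on (extensional A\<^sub>1) f\<^sub>1" "mono_on (extensional A\<^sub>2) f\<^sub>2"
    and ex: "covariance_exists M (\<lambda>\<omega>. f\<^sub>1 (\<lambda>i\<in>A\<^sub>1. - X i \<omega>)) (\<lambda>\<omega>. f\<^sub>2 (\<lambda>j\<in>A\<^sub>2. - X j \<omega>))"
  define h where "h = (\<lambda>A (f :: ('i \<Rightarrow> real) \<Rightarrow> real) x. - f (\<lambda>i\<in>A. - x i))"
  have h_mono: "mono_on (extensional A) (h A f)" if "mono_on (extensional A) f" for A f
    unfolding h_def
    by (intro mono_onI le_imp_neg_le mono_onD[OF that]) (auto simp: le_fun_def)
  have h_eq: "h A f (\<lambda>i\<in>A. X i \<omega>) = - f (\<lambda>i\<in>A. - X i \<omega>)" for A f \<omega>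
    unfolding h_def by (intro arg_cong[where f = uminus] arg_cong[where f = f]) auto
  have hex: "covariance_exists M (\<lambda>\<omega>. h A\<^sub>1 f\<^sub>1 (\<lambda>i\<in>A\<^sub>1. X i \<omega>)) (\<lambda>\<omega>. h A\<^sub>2 f\<^sub>2 (\<lambda>j\<in>A\<^sub>2. X j \<omega>))"
    using ex by (simp add: h_eq covariance_exists_def)
  have "negatively_associated_finite M J X"
    using assms J by (simp add: negatively_associated_def)
  then have "covariance M (\<lambda>\<omega>. h A\<^sub>1 f\<^sub>1 (\<lambda>i\<in>A\<^sub>1. X i \<omega>)) (\<lambda>\<omega>. h A\<^sub>2 f\<^sub>2 (\<lambda>j\<in>A\<^sub>2. X j \<omega>)) \<le> 0"
    using A h_mono[OF mono(1)] h_mono[OF mono(2)] hex by (rule negatively_associated_finiteD)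
  then show "covariance M (\<lambda>\<omega>. f\<^sub>1 (\<lambda>i\<in>A\<^sub>1. - X i \<omega>)) (\<lambda>\<omega>. f\<^sub>2 (\<lambda>j\<in>A\<^sub>2. - X j \<omega>)) \<le> 0"
    by (simp add: h_eq covariance_def algebra_simps)
qed

context prob_space
begin

lemma covariance_eq:
  assumes "covariance_exists M U V"
  shows "covariance M U V = expectation (\<lambda>\<omega>. U \<omega> * V \<omega>) - expectation U * expectation V"
proof -
  have [simp]: "integrable M U" "integrable M V" "integrable M (\<lambda>\<omega>. U \<omega> * V \<omega>)"
    using assms by (auto simp: covariance_exists_def)
  have "covariance M U V = expectation (\<lambda>\<omega>. U \<omega> * V \<omega> - expectation V * U \<omega> - expectation U * V \<omega>
      + expectation U * expectation V)"
    unfolding covariance_def by (simp add: algebra_simps)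
  then show ?thesis
    by (simp add: prob_space)
qed

lemma negatively_associated_expectation_prod_le:
  fixes X :: "'i \<Rightarrow> 'a \<Rightarrow> real" and g :: "real \<Rightarrow> real"
  assumes na: "negatively_associated M I X"
    and meas: "\<And>i. i \<in> I \<Longrightarrow> X i \<in> borel_measurable M"
    and "mono g" and g0: "\<And>x. 0 \<le> g x" and gb: "\<And>x. g x \<le> b"
    and "finite J" "J \<subseteq> I"
  shows "expectation (\<lambda>\<omega>. \<Prod>i\<in>J. g (X i \<omega>)) \<le> (\<Prod>i\<in>J. expectation (\<lambda>\<omega>. g (X i \<omega>)))"
  using \<open>finite J\<close> \<open>J \<subseteq> I\<close>
proof (induction J)
  case empty
  then show ?case by (simp add: prob_space)
next
  case (insert i J)
  let ?U = "\<lambda>\<omega>. g (X i \<omega>)" and ?V = "\<lambda>\<omega>. \<Prod>j\<in>J. g (X j \<omega>)"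
  have [measurable]: "g \<in> borel_measurable borel"
    using \<open>mono g\<close> by (rule borel_measurable_mono)
  have [measurable]: "X j \<in> borel_measurable M" if "j \<in> insert i J" for j
    using insert.prems meas that by auto
  have V0: "0 \<le> ?V \<omega>" and Vb: "?V \<omega> \<le> b ^ card J" for \<omega>
    using g0 gb prod_mono[of J "\<lambda>j. g (X j \<omega>)" "\<lambda>_. b"] by (auto intro: prod_nonneg)
  have b0: "0 \<le> b"
    using order_trans[OF g0 gb] .
  have "integrable M ?U"
    using g0 gb by (intro integrable_const_bound[where B = b] AE_I2) auto
  moreover have "integrable M ?V"
    using V0 Vb by (intro integrable_const_bound[where B = "b ^ card J"] AE_I2) auto
  moreover have "integrable M (\<lambda>\<omega>. ?U \<omega> * ?V \<omega>)"
    using g0 gb V0 Vb b0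
    by (intro integrable_const_bound[where B = "b * b ^ card J"] AE_I2)
      (auto simp: abs_mult abs_prod intro!: mult_mono)
  ultimately have ex: "covariance_exists M ?U ?V"
    by (simp add: covariance_exists_def)
  have "mono_on (extensional {i}) (\<lambda>x. g (x i))"
    by (intro mono_onI monoD[OF \<open>mono g\<close>]) (auto simp: le_fun_def)
  moreover have "mono_on (extensional J) (\<lambda>x. \<Prod>j\<in>J. g (x j))"
    using g0 by (intro mono_onI prod_mono conjI monoD[OF \<open>mono g\<close>]) (auto simp: le_fun_def)
  moreover have "negatively_associated_finite M (insert i J) X"
    using na insert unfolding negatively_associated_def by blast
  moreover have "{i} \<inter> J = {}"
    using insert by auto
  ultimately have "covariance M ?U ?V \<le> 0"
    using ex negatively_associated_finiteD[of M "insert i J" X "{i}" J "\<lambda>x. g (x i)" "\<lambda>x. \<Prod>j\<in>J. g (x j)"]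
    by (simp add: subset_insertI)
  then have "expectation (\<lambda>\<omega>. ?U \<omega> * ?V \<omega>) \<le> expectation ?U * expectation ?V"
    using covariance_eq[OF ex] by simp
  also have "\<dots> \<le> expectation ?U * (\<Prod>j\<in>J. expectation (\<lambda>\<omega>. g (X j \<omega>)))"
    using insert g0 by (intro mult_left_mono) auto
  finally show ?case
    using insert by simp
qed

lemma negatively_associated_prob_sum_clamp_le:
  fixes X :: "'i \<Rightarrow> 'a \<Rightarrow> real" and E a m y :: real
  assumes na: "negatively_associated M I X"
    and meas [measurable]: "\<And>i. i \<in> I \<Longrightarrow> X i \<in> borel_measurable M"
    and J: "finite J" "J \<subseteq> I" and "0 < y" "1 \<le> E"
    and mean: "\<And>i. i \<in> J \<Longrightarrow> expectation (\<lambda>\<omega>. min y (max 0 (X i \<omega>))) \<le> m"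
  shows "prob {\<omega>\<in>space M. a \<le> (\<Sum>i\<in>J. min y (max 0 (X i \<omega>)))}
    \<le> E powr (- (a / y)) * exp (card J * m * (E - 1) / y)"
proof -
  define c where "c x = min y (max 0 x)" for x :: real
  define g where "g x = E powr (c x / y)" for x
  have c0: "0 \<le> c x" and cy: "c x \<le> y" for x
    using \<open>0 < y\<close> by (auto simp: c_def)
  have [measurable]: "c \<in> borel_measurable borel" "g \<in> borel_measurable borel"
    unfolding g_def c_def by measurable
  have gE: "g x \<le> E" for x
    using \<open>1 \<le> E\<close> \<open>0 < y\<close> cy[of x] powr_mono[of "c x / y" 1 E] by (simp add: g_def)
  have "mono g"
    using \<open>1 \<le> E\<close> \<open>0 < y\<close> by (auto simp: g_def c_def mono_def intro!: powr_mono divide_right_mono)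
  have g_le: "g x \<le> 1 + c x * (E - 1) / y" for x
  proof -
    have "exp ((1 - c x / y) *\<^sub>R 0 + (c x / y) *\<^sub>R ln E) \<le> (1 - c x / y) * exp 0 + (c x / y) * exp (ln E)"
      using c0[of x] cy[of x] \<open>0 < y\<close> by (intro convex_onD[OF exp_convex]) auto
    then show ?thesis
      using \<open>1 \<le> E\<close> by (simp add: g_def powr_def algebra_simps diff_divide_distrib)
  qed
  have Eg: "expectation (\<lambda>\<omega>. g (X i \<omega>)) \<le> exp (m * (E - 1) / y)" if "i \<in> J" for i
  proof -
    have [measurable]: "X i \<in> borel_measurable M"
      using that J meas by auto
    have int: "integrable M (\<lambda>\<omega>. c (X i \<omega>))"
      using c0 cy by (intro integrable_const_bound[where B = y] AE_I2) auto
    have "expectation (\<lambda>\<omega>. g (X i \<omega>)) \<le> expectation (\<lambda>\<omega>. 1 + c (X i \<omega>) * (E - 1) / y)"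
    proof (rule integral_mono)
      show "integrable M (\<lambda>\<omega>. g (X i \<omega>))"
        using gE by (intro integrable_const_bound[where B = E] AE_I2) (auto simp: g_def)
    qed (use int g_le in auto)
    also have "\<dots> = 1 + expectation (\<lambda>\<omega>. c (X i \<omega>)) * (E - 1) / y"
      using int by (simp add: prob_space)
    also have "\<dots> \<le> 1 + m * (E - 1) / y"
      using mean[OF that] \<open>1 \<le> E\<close> \<open>0 < y\<close>
      by (intro add_left_mono divide_right_mono mult_right_mono) (auto simp: c_def)
    also have "\<dots> \<le> exp (m * (E - 1) / y)"
      by (rule exp_ge_add_one_self)
    finally show ?thesis .
  qed
  have prod_eq: "(\<Prod>i\<in>J. g (X i \<omega>)) = E powr ((\<Sum>i\<in>J. c (X i \<omega>)) / y)" for \<omega>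
    using \<open>1 \<le> E\<close> J by (simp add: g_def powr_def sum_distrib_right sum_divide_distrib exp_sum)
  have [measurable]: "X i \<in> borel_measurable M" if "i \<in> J" for i
    using that J meas by auto
  have int: "integrable M (\<lambda>\<omega>. \<Prod>i\<in>J. g (X i \<omega>))"
  proof (rule integrable_const_bound[where B = "E ^ card J"])
    have "(\<Prod>i\<in>J. g (X i \<omega>)) \<le> (\<Prod>i\<in>J. E)" for \<omega>
      using gE by (intro prod_mono) (auto simp: g_def)
    then show "AE \<omega> in M. norm (\<Prod>i\<in>J. g (X i \<omega>)) \<le> E ^ card J"
      by (intro AE_I2) (simp add: abs_prod g_def)
  qed measurable
  have "prob {\<omega>\<in>space M. a \<le> (\<Sum>i\<in>J. c (X i \<omega>))}
      \<le> prob {\<omega>\<in>space M. E powr (a / y) \<le> (\<Prod>i\<in>J. g (X i \<omega>))}"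
    using \<open>0 < y\<close> \<open>1 \<le> E\<close>
    by (intro finite_measure_mono) (auto simp: prod_eq intro!: powr_mono divide_right_mono)
  also have "\<dots> \<le> expectation (\<lambda>\<omega>. \<Prod>i\<in>J. g (X i \<omega>)) / E powr (a / y)"
    using int \<open>1 \<le> E\<close> by (intro integral_Markov_inequality_measure[where A = "{}"]) (auto simp: g_def prod_nonneg)
  also have "\<dots> \<le> (\<Prod>i\<in>J. expectation (\<lambda>\<omega>. g (X i \<omega>))) / E powr (a / y)"
    using na meas \<open>mono g\<close> gE J
    by (intro divide_right_mono negatively_associated_expectation_prod_le[where b = E and g = g]) (auto simp: g_def)
  also have "\<dots> \<le> (\<Prod>i\<in>J. exp (m * (E - 1) / y)) / E powr (a / y)"
    using Eg by (intro divide_right_mono prod_mono) (auto simp: g_def)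
  also have "\<dots> = E powr (- (a / y)) * exp (card J * m * (E - 1) / y)"
    by (simp add: powr_minus_divide flip: exp_of_nat_mult)
  finally show ?thesis
    by (simp add: c_def)
qed

end

lemma powr_power_commute: "0 < x \<Longrightarrow> (x powr s) ^ m = (x ^ m) powr s" for x :: real
  by (simp add: powr_realpow[symmetric] powr_powr mult.commute)

lemma summable_on_dyadicI:
  fixes a :: "nat \<Rightarrow> real"
  assumes nonneg: "\<And>n. 1 \<le> n \<Longrightarrow> 0 \<le> a n" and "summable Q"
    and le: "\<And>m n. 2 ^ m \<le> n \<Longrightarrow> n < 2 ^ Suc m \<Longrightarrow> a n \<le> Q m / 2 ^ m"
  shows "a summable_on {1..}"
proof (rule nonneg_bdd_above_summable_on)
  have Q0: "0 \<le> Q m" for m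
  proof -
    have "0 \<le> Q m / 2 ^ m * 2 ^ m"
      using order_trans[OF nonneg le, of "2 ^ m" m] by (intro mult_nonneg_nonneg) auto
    then show ?thesis by simp
  qed
  have dyadic: "sum a {1..<2 ^ N} \<le> (\<Sum>m<N. Q m)" for N
  proof (induction N)
    case (Suc N)
    have "{1..<2 ^ Suc N} = {1..<2 ^ N} \<union> {2 ^ N..<2 ^ Suc N :: nat}"
      by (subst ivl_disj_un) auto
    then have "sum a {1..<2 ^ Suc N} = sum a {1..<2 ^ N} + sum a {2 ^ N..<2 ^ Suc N}"
      by (simp only:) (intro sum.union_disjoint; auto)
    also have "sum a {2 ^ N..<2 ^ Suc N} \<le> (\<Sum>n\<in>{2 ^ N..<2 ^ Suc N :: nat}. Q N / 2 ^ N)"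
      by (intro sum_mono le) auto
    also have "\<dots> = Q N"
      by simp
    finally show ?case
      using Suc by simp
  qed simp
  show "bdd_above (sum a ` {F. F \<subseteq> {1..} \<and> finite F})"
  proof (rule bdd_aboveI2)
    fix F :: "nat set" assume F: "F \<in> {F. F \<subseteq> {1..} \<and> finite F}"
    have "n < 2 ^ Suc (Max F)" if "n \<in> F" for n
    proof -
      have "n \<le> Max F"
        using that F by auto
      also have "\<dots> < 2 ^ Max F"
        by simp
      also have "\<dots> \<le> 2 ^ Suc (Max F)"
        by simp
      finally show ?thesis .
    qed
    then have "sum a F \<le> sum a {1..<2 ^ Suc (Max F)}"
      using F nonneg by (intro sum_mono2) (auto simp: subset_iff)
    also have "\<dots> \<le> (\<Sum>m<Suc (Max F). Q m)"
      by (rule dyadic)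
    also have "\<dots> \<le> suminf Q"
      using \<open>summable Q\<close> Q0 by (intro sum_le_suminf) auto
    finally show "sum a F \<le> suminf Q" .
  qed
qed (use nonneg in auto)

locale dominated_moments = prob_space M for M :: "'a measure" +
  fixes X :: "nat \<Rightarrow> 'a \<Rightarrow> real" and f :: "real \<Rightarrow> real" and p r B :: real
  assumes X_meas [measurable]: "\<And>n. 1 \<le> n \<Longrightarrow> X n \<in> borel_measurable M"
    and f_pos: "\<And>x. 0 \<le> x \<Longrightarrow> 0 < f x"
    and f_mono: "mono_on {0..} f"
    and f_summable: "summable (\<lambda>n. 1 / f (2 ^ n))"
    and r_pos: "0 < r" and r_less: "r < 1" and p_ge: "1 \<le> p" and B_nonneg: "0 \<le> B"
    and moment: "\<And>n. 1 \<le> n \<Longrightarrow> (\<integral>\<^sup>+\<omega>. ennreal (\<bar>X n \<omega>\<bar> powr p * f \<bar>X n \<omega>\<bar>) \<partial>M) \<le> ennreal B"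
begin

definition \<phi> :: "real \<Rightarrow> real" where "\<phi> x = \<bar>x\<bar> powr p * f \<bar>x\<bar>"
definition c :: real where "c = 2 powr (1 / r)"

lemma f_le: "0 \<le> x \<Longrightarrow> x \<le> y \<Longrightarrow> f x \<le> f y"
  using f_mono by (auto simp: mono_on_def)

lemma \<phi>_measurable [measurable]: "\<phi> \<in> borel_measurable borel"
proof -
  have "mono (\<lambda>x. f (max 0 x))"
    by (auto simp: mono_def intro!: f_le)
  from borel_measurable_mono[OF this] have [measurable]: "(\<lambda>x. f (max 0 x)) \<in> borel_measurable borel" .
  have "\<phi> = (\<lambda>x. \<bar>x\<bar> powr p * (\<lambda>x. f (max 0 x)) \<bar>x\<bar>)"
    by (auto simp: \<phi>_def)
  also have "\<dots> \<in> borel_measurable borel"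
    by (intro borel_measurable_times measurable_compose[OF _ \<open>(\<lambda>x. f (max 0 x)) \<in> _\<close>]) auto
  finally show ?thesis .
qed

lemma \<phi>_nonneg: "0 \<le> \<phi> x"
  using f_pos[of "\<bar>x\<bar>"] by (simp add: \<phi>_def)

lemma \<phi>_mono: "0 \<le> x \<Longrightarrow> x \<le> y \<Longrightarrow> \<phi> x \<le> \<phi> y"
  using f_pos[of x] p_ge by (auto simp: \<phi>_def intro!: mult_mono powr_mono2 f_le)

lemma \<phi>_pos: "0 < x \<Longrightarrow> 0 < \<phi> x"
  using f_pos[of x] by (simp add: \<phi>_def)

lemma integrable_\<phi>: "integrable M (\<lambda>\<omega>. \<phi> (X n \<omega>))"
  and expectation_\<phi>_le: "expectation (\<lambda>\<omega>. \<phi> (X n \<omega>)) \<le> B" if "1 \<le> n"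
proof -
  have [measurable]: "X n \<in> borel_measurable M"
    using that by simp
  have le: "(\<integral>\<^sup>+\<omega>. ennreal (\<phi> (X n \<omega>)) \<partial>M) \<le> ennreal B"
    using moment[OF that] by (simp add: \<phi>_def)
  show int: "integrable M (\<lambda>\<omega>. \<phi> (X n \<omega>))"
    using le \<phi>_nonneg by (intro integrableI_nonneg) (auto simp: order_le_less_trans[OF _ ennreal_less_top])
  show "expectation (\<lambda>\<omega>. \<phi> (X n \<omega>)) \<le> B"
    using le \<phi>_nonneg B_nonneg int by (simp add: nn_integral_eq_integral)
qed

lemma expectation_le_if_dominated:
  assumes "1 \<le> n" and [measurable]: "g \<in> borel_measurable borel"
    and "\<And>x. 0 \<le> g x" "\<And>x. g x \<le> K + H * \<phi> x" and "0 \<le> H"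
  shows "expectation (\<lambda>\<omega>. g (X n \<omega>)) \<le> K + H * B"
proof -
  have [measurable]: "X n \<in> borel_measurable M"
    using assms(1) by simp
  have int: "integrable M (\<lambda>\<omega>. K + H * \<phi> (X n \<omega>))"
    using integrable_\<phi>[OF assms(1)] by simp
  have "expectation (\<lambda>\<omega>. g (X n \<omega>)) \<le> expectation (\<lambda>\<omega>. K + H * \<phi> (X n \<omega>))"
    using assms int order_trans[OF assms(3,4)] by (intro integral_mono') auto
  also have "\<dots> = K + H * expectation (\<lambda>\<omega>. \<phi> (X n \<omega>))"
    using integrable_\<phi>[OF assms(1)] by (simp add: prob_space)
  also have "\<dots> \<le> K + H * B"
    using expectation_\<phi>_le[OF assms(1)] \<open>0 \<le> H\<close> by (intro add_left_mono mult_left_mono)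
  finally show ?thesis .
qed

lemma prob_greater_le:
  assumes "1 \<le> n" "0 < a"
  shows "prob {\<omega>\<in>space M. a < X n \<omega>} \<le> B / \<phi> a"
proof -
  have [measurable]: "X n \<in> borel_measurable M"
    using assms(1) by simp
  have "prob {\<omega>\<in>space M. a < X n \<omega>} \<le> prob {\<omega>\<in>space M. \<phi> a \<le> \<phi> (X n \<omega>)}"
    using \<open>0 < a\<close> by (intro finite_measure_mono) (auto intro: \<phi>_mono)
  also have "\<dots> \<le> expectation (\<lambda>\<omega>. \<phi> (X n \<omega>)) / \<phi> a"
    using assms integrable_\<phi> \<phi>_nonneg \<phi>_pos by (intro integral_Markov_inequality_measure[where A = "{}"]) auto
  also have "\<dots> \<le> B / \<phi> a"
    using expectation_\<phi>_le[OF assms(1)] \<phi>_nonneg by (intro divide_right_mono)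
  finally show ?thesis .
qed

lemma prob_sum_pos_le:
  assumes "0 < a"
  shows "prob {\<omega>\<in>space M. s < (\<Sum>i=1..n. max 0 (X i \<omega>))} \<le>
    n * (B / \<phi> a) + prob {\<omega>\<in>space M. s \<le> (\<Sum>i=1..n. min a (max 0 (X i \<omega>)))}"
proof -
  let ?L = "\<Union>i\<in>{1..n}. {\<omega>\<in>space M. a < X i \<omega>}"
  let ?T = "{\<omega>\<in>space M. s \<le> (\<Sum>i=1..n. min a (max 0 (X i \<omega>)))}"
  have "\<omega> \<in> ?L \<union> ?T" if "\<omega> \<in> space M" "s < (\<Sum>i=1..n. max 0 (X i \<omega>))" for \<omega>
  proof (cases "\<omega> \<in> ?L")
    case False
    then have "(\<Sum>i=1..n. min a (max 0 (X i \<omega>))) = (\<Sum>i=1..n. max 0 (X i \<omega>))"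
      using that \<open>0 < a\<close> by (intro sum.cong) (auto simp: not_less)
    then show ?thesis using that by simp
  qed simp
  then have "prob {\<omega>\<in>space M. s < (\<Sum>i=1..n. max 0 (X i \<omega>))} \<le> prob (?L \<union> ?T)"
    by (intro finite_measure_mono) auto
  also have "\<dots> \<le> prob ?L + prob ?T"
    by (intro measure_Un_le) auto
  also have "prob ?L \<le> (\<Sum>i\<in>{1..n}. prob {\<omega>\<in>space M. a < X i \<omega>})"
    by (intro finite_measure_subadditive_finite) auto
  also have "\<dots> \<le> (\<Sum>i\<in>{1..n}. B / \<phi> a)"
    using \<open>0 < a\<close> by (intro sum_mono prob_greater_le) auto
  finally show ?thesis by simp
qed

lemma c_gt_2: "2 < c"
  using r_pos r_less powr_less_mono[of 1 "1 / r" 2] by (simp add: c_def)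

lemma c_powr_power: "(c powr s) ^ m = (c ^ m) powr s"
  using c_gt_2 by (simp add: powr_power_commute)

lemma summable_f_scaled:
  assumes "0 < \<delta>"
  shows "summable (\<lambda>m. 1 / f (\<delta> * c ^ m))"
proof -
  obtain j where j: "1 / \<delta> < 2 ^ j"
    using real_arch_pow[of 2] by auto
  have le: "2 ^ m \<le> \<delta> * c ^ (m + j)" for m
  proof -
    have "2 ^ m * 1 \<le> 2 ^ m * (\<delta> * 2 ^ j)"
      using j \<open>0 < \<delta>\<close> by (intro mult_left_mono) (auto simp: field_simps)
    also have "\<dots> = \<delta> * 2 ^ (m + j)"
      by (simp add: power_add)
    also have "\<dots> \<le> \<delta> * c ^ (m + j)"
      using c_gt_2 \<open>0 < \<delta>\<close> by (intro mult_left_mono power_mono) auto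
    finally show ?thesis by simp
  qed
  have "summable (\<lambda>m. 1 / f (\<delta> * c ^ (m + j)))"
  proof (rule summable_comparison_test'[OF f_summable])
    fix m :: nat
    show "norm (1 / f (\<delta> * c ^ (m + j))) \<le> 1 / f (2 ^ m)"
      using f_pos[of "2 ^ m"] f_le[OF _ le] order_less_le_trans[OF f_pos f_le[OF _ le], of m]
      by (auto intro!: divide_left_mono)
  qed
  then show ?thesis
    using summable_iff_shift[of "\<lambda>m. 1 / f (\<delta> * c ^ m)" j] by simp
qed

lemma summable_large_values:
  assumes "0 < \<delta>"
  shows "summable (\<lambda>m. (c powr p / 2) ^ m * (2 ^ m * (B / \<phi> (\<delta> * c ^ m))))"
proof -
  have "(c powr p / 2) ^ m * (2 ^ m * (B / \<phi> (\<delta> * c ^ m))) = B / \<delta> powr p * (1 / f (\<delta> * c ^ m))" for m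
  proof -
    have "\<phi> (\<delta> * c ^ m) = \<delta> powr p * (c powr p) ^ m * f (\<delta> * c ^ m)"
      using assms c_gt_2 by (simp add: \<phi>_def c_powr_power powr_mult)
    then show ?thesis
      using c_gt_2 by (simp add: power_divide)
  qed
  then show ?thesis
    using summable_mult[OF summable_f_scaled[OF assms]] by (simp only:)
qed

lemma mean_clamp_le:
  assumes "1 \<le> n" "0 < a"
  shows "expectation (\<lambda>\<omega>. min a (max 0 (X n \<omega>))) \<le> 1 + 1 / f 1 * B"
proof (rule expectation_le_if_dominated[OF assms(1)])
  fix x :: real
  show "min a (max 0 x) \<le> 1 + 1 / f 1 * \<phi> x"
  proof (cases "x \<le> 1")
    case True
    then have "min a (max 0 x) \<le> 1" by auto
    then show ?thesis
      using f_pos[of 1] \<phi>_nonneg[of x] by (intro add_increasing2) auto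
  next
    case False
    then have "x * f 1 \<le> \<phi> x"
      using p_ge f_pos[of 1] powr_mono[of 1 p x] by (auto simp: \<phi>_def intro!: mult_mono f_le)
    then have "x \<le> 1 / f 1 * \<phi> x"
      using f_pos[of 1] by (simp add: field_simps)
    then show ?thesis
      using False by auto
  qed
qed (use assms f_pos[of 1] in auto)

text \<open>Bounds \<open>x powr (2 - p) / f x\<close> for \<open>0 < x \<le> c ^ m\<close>, level by level.\<close>

definition H :: "nat \<Rightarrow> real" where
  "H m = 1 / f 0 + (\<Sum>k\<le>m. (c powr (2 - p)) ^ Suc k / f (c ^ k))"

lemma second_moment_clamp_le:
  assumes "1 \<le> n" "p < 2"
  shows "expectation (\<lambda>\<omega>. (min (c ^ m) (max 0 (X n \<omega>)))\<^sup>2) \<le> B * H m"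
proof -
  have f_c: "0 < f (c ^ k)" for k
    using f_pos c_gt_2 by simp
  have H_parts: "0 < H m" "1 / f 0 \<le> H m" "\<And>k. k \<le> m \<Longrightarrow> (c powr (2 - p)) ^ Suc k / f (c ^ k) \<le> H m"
  proof -
    have nn: "0 \<le> (c powr (2 - p)) ^ Suc k / f (c ^ k)" for k
      using f_c[of k] by (intro divide_nonneg_nonneg zero_le_power) auto
    then have s: "0 \<le> (\<Sum>k\<le>m. (c powr (2 - p)) ^ Suc k / f (c ^ k))"
      by (rule sum_nonneg)
    show "1 / f 0 \<le> H m"
      using s by (simp add: H_def)
    with f_pos[of 0] show "0 < H m"
      by (smt (verit) zero_less_divide_1_iff)
    show "(c powr (2 - p)) ^ Suc k / f (c ^ k) \<le> H m" if "k \<le> m" for k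
      using member_le_sum[of k "{..m}" "\<lambda>k. (c powr (2 - p)) ^ Suc k / f (c ^ k)"] that nn f_pos[of 0]
      unfolding H_def by (intro add_increasing) auto
  qed
  have level: "1 \<le> u \<Longrightarrow> u \<le> c ^ m \<Longrightarrow> \<exists>k\<le>m. c ^ k \<le> u \<and> u \<le> c ^ Suc k" for u
  proof (induction m)
    case (Suc m)
    then show ?case
      by (cases "u \<le> c ^ m") (auto intro: le_SucI)
  qed (use c_gt_2 in auto)
  have ratio: "u powr (2 - p) \<le> H m * f u" if u: "0 < u" "u \<le> c ^ m" for u
  proof (cases "u < 1")
    case True
    have "u powr (2 - p) \<le> 1"
      using True u \<open>p < 2\<close> by (intro powr_le1) auto
    also have "1 \<le> H m * f 0"
      using H_parts(2) f_pos[of 0] by (simp add: field_simps)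
    also have "\<dots> \<le> H m * f u"
      using H_parts(1) u by (intro mult_left_mono f_le) auto
    finally show ?thesis .
  next
    case False
    with level[of u] u obtain k where k: "k \<le> m" "c ^ k \<le> u" "u \<le> c ^ Suc k"
      by fastforce
    have "u powr (2 - p) \<le> (c ^ Suc k) powr (2 - p)"
      using k u \<open>p < 2\<close> by (intro powr_mono2) auto
    also have "\<dots> = (c powr (2 - p)) ^ Suc k"
      by (simp only: c_powr_power)
    also have "\<dots> \<le> H m * f (c ^ k)"
      using H_parts(3)[OF k(1)] f_c[of k] by (simp add: pos_divide_le_eq)
    also have "\<dots> \<le> H m * f u"
      using H_parts(1) k c_gt_2 by (intro mult_left_mono f_le) auto
    finally show ?thesis .
  qed
  have "(min (c ^ m) (max 0 x))\<^sup>2 \<le> 0 + H m * \<phi> x" for x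
  proof (cases "x \<le> 0")
    case True
    then show ?thesis
      using c_gt_2 H_parts(1) \<phi>_nonneg[of x] by (simp add: max_absorb1)
  next
    case False
    define u where "u = min (c ^ m) x"
    have u: "0 < u" "u \<le> c ^ m" "u \<le> x"
      using False c_gt_2 by (auto simp: u_def)
    have "u\<^sup>2 = u powr p * u powr (2 - p)"
      using u by (simp flip: powr_add powr_numeral)
    also have "\<dots> \<le> u powr p * (H m * f u)"
      using ratio u by (intro mult_left_mono) auto
    also have "\<dots> = H m * \<phi> u"
      using u by (simp add: \<phi>_def)
    also have "\<dots> \<le> H m * \<phi> x"
      using H_parts(1) u by (intro mult_left_mono \<phi>_mono) auto
    finally show ?thesis
      using False by (simp add: u_def)
  qed
  then show ?thesis
    using expectation_le_if_dominated[OF assms(1), of "\<lambda>x. (min (c ^ m) (max 0 x))\<^sup>2" 0 "H m"] H_parts(1)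
    by (simp add: mult.commute)
qed

lemma summable_H:
  assumes "p < 2"
  shows "summable (\<lambda>m. (c powr (p - 2)) ^ m * H m)"
proof -
  let ?\<rho> = "c powr (p - 2)" and ?d = "c powr (2 - p)"
  have \<rho>: "0 < ?\<rho>" "?\<rho> < 1"
    using c_gt_2 assms by (auto simp: powr_less_one)
  have \<rho>d: "?\<rho> * ?d = 1"
    using c_gt_2 by (simp flip: powr_add)
  have eq: "?\<rho> ^ m * H m = 1 / f 0 * ?\<rho> ^ m + ?d * (\<Sum>k\<le>m. 1 / f (c ^ k) * ?\<rho> ^ (m - k))" for m
  proof -
    have "?\<rho> ^ m * (?d ^ Suc k / f (c ^ k)) = ?d * (1 / f (c ^ k) * ?\<rho> ^ (m - k))" if "k \<le> m" for k
    proof -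
      have "?\<rho> ^ m * ?d ^ Suc k = ?d * ?\<rho> ^ (m - k) * (?\<rho> * ?d) ^ k"
        using that by (simp add: power_mult_distrib flip: power_add)
      then show ?thesis
        using \<rho>d by simp
    qed
    then show ?thesis
      unfolding H_def distrib_left sum_distrib_left by (intro arg_cong2[where f = "(+)"] sum.cong) auto
  qed
  have "summable (\<lambda>m. \<Sum>k\<le>m. 1 / f (c ^ k) * ?\<rho> ^ (m - k))"
  proof (rule summable_Cauchy_product)
    show "summable (\<lambda>k. norm (1 / f (c ^ k)))"
      using summable_f_scaled[of 1] f_pos c_gt_2 by (simp add: less_imp_le)
    show "summable (\<lambda>k. norm (?\<rho> ^ k))"
      using \<rho> by (simp add: summable_geometric)
  qed
  then show ?thesis
    unfolding eq using \<rho> by (intro summable_add summable_mult summable_geometric) auto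
qed

lemma summable_truncated_NQD:
  assumes "p < 2" "pairwise_NQD M {1..} X" "0 < \<epsilon>"
  shows "summable (\<lambda>m. (c powr p / 2) ^ m *
    prob {\<omega>\<in>space M. \<epsilon> * c ^ m \<le> (\<Sum>i=1..2 ^ m. min (c ^ m) (max 0 (X i \<omega>)))})"
proof (rule summable_comparison_test_ev)
  define \<mu> where "\<mu> = 1 + 1 / f 1 * B"
  obtain N where N: "2 * \<mu> / \<epsilon> < (c / 2) ^ N"
    using real_arch_pow[of "c / 2"] c_gt_2 by auto
  have "2 * \<mu> / \<epsilon> \<le> (c / 2) ^ m" if "N \<le> m" for m
    using c_gt_2 by (intro order_trans[OF less_imp_le[OF N] power_increasing[OF that]]) auto
  then have "\<forall>\<^sub>F m in sequentially. 2 * \<mu> / \<epsilon> \<le> (c / 2) ^ m"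
    by (rule eventually_sequentiallyI)
  then show "\<forall>\<^sub>F m in sequentially. norm ((c powr p / 2) ^ m *
      prob {\<omega>\<in>space M. \<epsilon> * c ^ m \<le> (\<Sum>i=1..2 ^ m. min (c ^ m) (max 0 (X i \<omega>)))})
      \<le> 4 * B / \<epsilon>\<^sup>2 * ((c powr (p - 2)) ^ m * H m)"
  proof eventually_elim
    case (elim m)
    define b where "b = c ^ m"
    define Y where "Y = (\<lambda>i \<omega>. min b (max 0 (X i \<omega>)))"
    have b: "0 < b"
      using c_gt_2 by (simp add: b_def)
    have small: "2 ^ m * \<mu> \<le> \<epsilon> * b / 2"
      using elim \<open>0 < \<epsilon>\<close> by (simp add: b_def power_divide field_simps)
    have mean: "(\<Sum>i=1..2 ^ m. expectation (Y i)) \<le> \<epsilon> * b / 2"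
    proof -
      have "(\<Sum>i=1..2 ^ m. expectation (Y i)) \<le> (\<Sum>i\<in>{1..2 ^ m :: nat}. \<mu>)"
        unfolding Y_def \<mu>_def using b by (intro sum_mono mean_clamp_le) auto
      with small show ?thesis by simp
    qed
    have "pairwise_NQD M {1..2 ^ m} Y"
      using assms(2) b NQD_clamp unfolding pairwise_NQD_def pairwise_def Y_def by auto
    then have dev: "prob {\<omega>\<in>space M. \<epsilon> * b / 2 \<le> (\<Sum>i=1..2 ^ m. Y i \<omega>) - (\<Sum>i=1..2 ^ m. expectation (Y i))}
        \<le> (\<Sum>i=1..2 ^ m. expectation (\<lambda>\<omega>. (Y i \<omega>)\<^sup>2)) / (\<epsilon> * b / 2)\<^sup>2"
      using b \<open>0 < \<epsilon>\<close> by (intro prob_sum_deviation_le[where b = b]) (auto simp: Y_def)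
    have [measurable]: "Y i \<in> borel_measurable M" if "1 \<le> i" for i
      using X_meas[OF that] by (simp add: Y_def)
    have "prob {\<omega>\<in>space M. \<epsilon> * b \<le> (\<Sum>i=1..2 ^ m. Y i \<omega>)} \<le>
        prob {\<omega>\<in>space M. \<epsilon> * b / 2 \<le> (\<Sum>i=1..2 ^ m. Y i \<omega>) - (\<Sum>i=1..2 ^ m. expectation (Y i))}"
      using mean by (intro finite_measure_mono) auto
    also note dev
    also have "(\<Sum>i=1..2 ^ m. expectation (\<lambda>\<omega>. (Y i \<omega>)\<^sup>2)) \<le> (\<Sum>i\<in>{1..2 ^ m :: nat}. B * H m)"
      unfolding Y_def b_def using \<open>p < 2\<close> by (intro sum_mono second_moment_clamp_le) auto
    finally have "prob {\<omega>\<in>space M. \<epsilon> * b \<le> (\<Sum>i=1..2 ^ m. Y i \<omega>)} \<le> 2 ^ m * (B * H m) / (\<epsilon> * b / 2)\<^sup>2"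
      by (simp add: divide_right_mono)
    then have "(c powr p / 2) ^ m * prob {\<omega>\<in>space M. \<epsilon> * b \<le> (\<Sum>i=1..2 ^ m. Y i \<omega>)} \<le>
        (c powr p / 2) ^ m * (2 ^ m * (B * H m) / (\<epsilon> * b / 2)\<^sup>2)"
      by (intro mult_left_mono) auto
    also have "\<dots> = 4 * B / \<epsilon>\<^sup>2 * ((c powr p) ^ m / b\<^sup>2 * H m)"
      by (simp add: power_divide power_mult_distrib)
    also have "(c powr p) ^ m / b\<^sup>2 = (c powr (p - 2)) ^ m"
    proof -
      have "c powr (p - 2) = c powr p / c\<^sup>2"
        using c_gt_2 by (simp add: powr_diff powr_numeral)
      then show ?thesis
        by (simp add: b_def power_divide mult.commute flip: power_mult)
    qed
    finally show ?case
      by (simp add: Y_def b_def abs_mult)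
  qed
  show "summable (\<lambda>m. 4 * B / \<epsilon>\<^sup>2 * ((c powr (p - 2)) ^ m * H m))"
    using summable_H[OF \<open>p < 2\<close>] by (rule summable_mult)
qed

text \<open>The truncation level is chosen so small that the Chernoff bound with \<open>E = (c / 2) ^ m\<close>
  beats the weight \<open>(c powr p / 2) ^ m\<close>.\<close>

lemma summable_truncated_negatively_associated:
  assumes "negatively_associated M {1..} X" "0 < \<epsilon>"
  obtains \<delta> where "0 < \<delta>"
    "summable (\<lambda>m. (c powr p / 2) ^ m *
      prob {\<omega>\<in>space M. \<epsilon> * c ^ m \<le> (\<Sum>i=1..2 ^ m. min (\<delta> * c ^ m) (max 0 (X i \<omega>)))})"
proof
  define \<mu> where "\<mu> = 1 + 1 / f 1 * B"
  define \<delta> where "\<delta> = \<epsilon> * ln (c / 2) / (p * ln c)"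
  have ln_pos: "0 < ln (c / 2)" "0 < p * ln c"
    using c_gt_2 p_ge by auto
  show \<delta>: "0 < \<delta>"
    using ln_pos \<open>0 < \<epsilon>\<close> by (simp add: \<delta>_def)
  have \<mu>: "0 \<le> \<mu>"
    using B_nonneg f_pos[of 1] by (simp add: \<mu>_def)
  have ratio: "(c / 2) powr (- (\<epsilon> / \<delta>)) = c powr (- p)"
    using c_gt_2 ln_pos \<open>0 < \<epsilon>\<close> p_ge by (simp add: powr_def \<delta>_def)
  show "summable (\<lambda>m. (c powr p / 2) ^ m *
      prob {\<omega>\<in>space M. \<epsilon> * c ^ m \<le> (\<Sum>i=1..2 ^ m. min (\<delta> * c ^ m) (max 0 (X i \<omega>)))})"
  proof (rule summable_comparison_test')
    show "summable (\<lambda>m. exp (\<mu> / \<delta>) * (1 / 2 :: real) ^ m)"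
      by (intro summable_mult summable_geometric) simp
  next
    fix m :: nat
    define E where "E = (c / 2) ^ m"
    have E: "1 \<le> E"
      using c_gt_2 by (simp add: E_def one_le_power)
    have "prob {\<omega>\<in>space M. \<epsilon> * c ^ m \<le> (\<Sum>i=1..2 ^ m. min (\<delta> * c ^ m) (max 0 (X i \<omega>)))}
        \<le> E powr (- (\<epsilon> * c ^ m / (\<delta> * c ^ m))) * exp (card {1..2 ^ m :: nat} * \<mu> * (E - 1) / (\<delta> * c ^ m))"
      using assms(1) E \<delta> c_gt_2 unfolding \<mu>_def
      by (intro negatively_associated_prob_sum_clamp_le[where I = "{1..}"] mean_clamp_le) auto
    also have "E powr (- (\<epsilon> * c ^ m / (\<delta> * c ^ m))) = (c powr (- p)) ^ m"
      using c_gt_2 by (simp add: E_def ratio flip: powr_power_commute)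
    also have "(c powr (- p)) ^ m * exp (card {1..2 ^ m :: nat} * \<mu> * (E - 1) / (\<delta> * c ^ m))
        \<le> (c powr (- p)) ^ m * exp (\<mu> / \<delta>)"
    proof -
      have "card {1..2 ^ m :: nat} * \<mu> * (E - 1) / (\<delta> * c ^ m) \<le> card {1..2 ^ m :: nat} * \<mu> * E / (\<delta> * c ^ m)"
        using \<mu> \<delta> c_gt_2 by (intro divide_right_mono mult_left_mono) auto
      also have "\<dots> = \<mu> / \<delta>"
        using c_gt_2 by (simp add: E_def power_divide)
      finally show ?thesis by (intro mult_left_mono) auto
    qed
    finally have "(c powr p / 2) ^ m *
        prob {\<omega>\<in>space M. \<epsilon> * c ^ m \<le> (\<Sum>i=1..2 ^ m. min (\<delta> * c ^ m) (max 0 (X i \<omega>)))}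
        \<le> (c powr p / 2) ^ m * ((c powr (- p)) ^ m * exp (\<mu> / \<delta>))"
      by (intro mult_left_mono) auto
    also have "\<dots> = exp (\<mu> / \<delta>) * (c powr p / 2 * c powr (- p)) ^ m"
      by (simp only: power_mult_distrib mult_ac)
    also have "c powr p / 2 * c powr (- p) = 1 / 2"
      using c_gt_2 by (simp add: powr_minus field_simps)
    finally show "norm ((c powr p / 2) ^ m *
        prob {\<omega>\<in>space M. \<epsilon> * c ^ m \<le> (\<Sum>i=1..2 ^ m. min (\<delta> * c ^ m) (max 0 (X i \<omega>)))})
        \<le> exp (\<mu> / \<delta>) * (1 / 2) ^ m"
      by (simp add: abs_mult)
  qed
qed

lemma summable_pos_part_sums:
  assumes "p < 2 \<Longrightarrow> pairwise_NQD M {1..} X" "2 \<le> p \<Longrightarrow> negatively_associated M {1..} X" and "0 < \<epsilon>"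
  shows "summable (\<lambda>m. (c powr p / 2) ^ m *
    prob {\<omega>\<in>space M. \<epsilon> * c ^ m < (\<Sum>i=1..2 ^ m. max 0 (X i \<omega>))})"
proof -
  obtain \<delta> where \<delta>: "0 < \<delta>"
    and trunc: "summable (\<lambda>m. (c powr p / 2) ^ m *
      prob {\<omega>\<in>space M. \<epsilon> * c ^ m \<le> (\<Sum>i=1..2 ^ m. min (\<delta> * c ^ m) (max 0 (X i \<omega>)))})"
  proof (cases "p < 2")
    case True
    from summable_truncated_NQD[OF True assms(1)[OF True] assms(3)] show ?thesis
      by (intro that[of 1]) auto
  next
    case False
    then show ?thesis
      using summable_truncated_negatively_associated[OF assms(2) assms(3)] that by auto
  qed
  show ?thesis
  proof (rule summable_comparison_test'[OF summable_add[OF summable_large_values[OF \<delta>] trunc]])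
    fix m :: nat
    have "0 < \<delta> * c ^ m"
      using \<delta> c_gt_2 by simp
    from prob_sum_pos_le[OF this, of "\<epsilon> * c ^ m" "2 ^ m"]
    show "norm ((c powr p / 2) ^ m * prob {\<omega>\<in>space M. \<epsilon> * c ^ m < (\<Sum>i=1..2 ^ m. max 0 (X i \<omega>))}) \<le>
        (c powr p / 2) ^ m * (2 ^ m * (B / \<phi> (\<delta> * c ^ m))) + (c powr p / 2) ^ m *
        prob {\<omega>\<in>space M. \<epsilon> * c ^ m \<le> (\<Sum>i=1..2 ^ m. min (\<delta> * c ^ m) (max 0 (X i \<omega>)))}"
      using c_gt_2 unfolding distrib_left[symmetric] real_norm_def abs_mult
      by (simp add: mult_left_mono del: times_divide_eq_right)
  qed
qed

end

lemma max_partial_sum_le: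
  assumes "1 \<le> n" "n \<le> k"
  shows "max_partial_sum X n \<omega> \<le> (\<Sum>i=1..k. max 0 (X i \<omega>)) + (\<Sum>i=1..k. max 0 (- X i \<omega>))"
proof -
  have "\<bar>partial_sum X j \<omega>\<bar> \<le> (\<Sum>i=1..k. max 0 (X i \<omega>)) + (\<Sum>i=1..k. max 0 (- X i \<omega>))" if "j \<in> {1..n}" for j
  proof -
    have "\<bar>partial_sum X j \<omega>\<bar> \<le> (\<Sum>i=1..j. \<bar>X i \<omega>\<bar>)"
      unfolding partial_sum_def by (rule sum_abs)
    also have "\<dots> \<le> (\<Sum>i=1..k. \<bar>X i \<omega>\<bar>)"
      using that assms by (intro sum_mono2) auto
    also have "\<dots> = (\<Sum>i=1..k. max 0 (X i \<omega>)) + (\<Sum>i=1..k. max 0 (- X i \<omega>))"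
      unfolding sum.distrib[symmetric] by (intro sum.cong) auto
    finally show ?thesis .
  qed
  then show ?thesis
    using assms by (auto simp: max_partial_sum_def)
qed

theorem corollary6p3:
  fixes M :: "'a measure"
    and X :: "nat \<Rightarrow> 'a \<Rightarrow> real"
    and f :: "real \<Rightarrow> real"
    and p r \<epsilon> :: real
  assumes "prob_space M"
    and "\<And>n. n \<ge> 1 \<Longrightarrow> X n \<in> borel_measurable M"
    and "\<And>x. x \<ge> 0 \<Longrightarrow> f x > 0"
    and "mono_on {0..} f"
    and "(\<lambda>n::nat. 1 / f (2 ^ n)) summable_on {1..}"
    and "0 < r" and "r < 1" and "1 \<le> p"
    and "p < 2 \<Longrightarrow> pairwise_NQD M {1..} X"
    and "p \<ge> 2 \<Longrightarrow> negatively_associated M {1..} X"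
    and "(SUP n\<in>{1..}. \<integral>\<^sup>+\<omega>. ennreal (\<bar>X n \<omega>\<bar> powr p * f \<bar>X n \<omega>\<bar>) \<partial>M) < \<infinity>"
    and "\<epsilon> > 0"
  shows "(\<lambda>n::nat. real n powr (p / r - 2) *
            measure M {\<omega> \<in> space M. max_partial_sum X n \<omega> > \<epsilon> * real n powr (1 / r)})
         summable_on {1..}"
proof -
  interpret prob_space M by fact
  define B where "B = enn2real (SUP n\<in>{1..}. \<integral>\<^sup>+\<omega>. ennreal (\<bar>X n \<omega>\<bar> powr p * f \<bar>X n \<omega>\<bar>) \<partial>M)"
  have moment: "(\<integral>\<^sup>+\<omega>. ennreal (\<bar>X n \<omega>\<bar> powr p * f \<bar>X n \<omega>\<bar>) \<partial>M) \<le> ennreal B" if "1 \<le> n" for n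
    using assms(11) that by (auto simp: B_def less_top intro!: SUP_upper)
  have "(\<lambda>n. 1 / f (2 ^ n)) summable_on {0} \<union> {1..}"
    using assms(5) by (intro summable_on_Un_disjoint) auto
  also have "{0} \<union> {1..} = (UNIV :: nat set)"
    by auto
  finally have f_summable: "summable (\<lambda>n. 1 / f (2 ^ n))"
    by (rule summable_on_imp_summable)
  interpret pos: dominated_moments M X f p r B
    using assms moment f_summable by unfold_locales (auto simp: B_def)
  interpret neg: dominated_moments M "\<lambda>i \<omega>. - X i \<omega>" f p r B
    using assms moment f_summable by unfold_locales (auto simp: B_def)
  define c where "c = 2 powr (1 / r)"
  have c_eq: "pos.c = c" "neg.c = c"
    by (simp_all add: c_def pos.c_def neg.c_def)
  have c: "2 < c"
    using pos.c_gt_2 by (simp add: c_eq)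
  have c_power: "c ^ m = (2 ^ m) powr (1 / r)" for m
    by (simp add: c_def powr_power_commute)
  define S where "S = (\<lambda>(Z :: nat \<Rightarrow> 'a \<Rightarrow> real) m \<omega>. \<Sum>i=1..2 ^ m. max 0 (Z i \<omega>))"
  define \<eta> where "\<eta> = \<epsilon> / (2 * c)"
  define w where "w m = (c powr p / 2) ^ m" for m
  define R where "R Z m = prob {\<omega>\<in>space M. \<eta> * c ^ m < S Z m \<omega>}" for Z and m :: nat
  define s where "s = p / r - 2"
  define K where "K = max 1 (2 powr (- s))"
  have "0 < \<eta>"
    using c assms(12) by (simp add: \<eta>_def)
  have "pairwise_NQD M {1..} (\<lambda>i \<omega>. - X i \<omega>)" if "p < 2"
    using assms(2) assms(9)[OF that] by (auto simp: pairwise_NQD_def pairwise_def intro!: NQD_uminus)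
  moreover have "negatively_associated M {1..} (\<lambda>i \<omega>. - X i \<omega>)" if "2 \<le> p"
    using negatively_associated_uminus[OF assms(10)[OF that]] .
  ultimately have "summable (\<lambda>m. w m * R (\<lambda>i \<omega>. - X i \<omega>) m)"
    using neg.summable_pos_part_sums[OF _ _ \<open>0 < \<eta>\<close>] by (simp add: w_def R_def S_def c_eq)
  moreover have "summable (\<lambda>m. w m * R X m)"
    using pos.summable_pos_part_sums[OF assms(9,10) \<open>0 < \<eta>\<close>] by (simp add: w_def R_def S_def c_eq)
  ultimately have "summable (\<lambda>m. w m * R X m + w m * R (\<lambda>i \<omega>. - X i \<omega>) m)"
    by (intro summable_add)
  then have "summable (\<lambda>m. w (Suc m) * R X (Suc m) + w (Suc m) * R (\<lambda>i \<omega>. - X i \<omega>) (Suc m))"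
    by (subst summable_Suc_iff)
  then have Q: "summable (\<lambda>m. K / 2 * (w (Suc m) * R X (Suc m) + w (Suc m) * R (\<lambda>i \<omega>. - X i \<omega>) (Suc m)))"
    by (rule summable_mult)
  show ?thesis
  proof (rule summable_on_dyadicI[OF _ Q])
    fix m n :: nat assume n: "2 ^ m \<le> n" "n < 2 ^ Suc m"
    have n_real: "2 ^ m \<le> real n" "real n \<le> 2 ^ Suc m"
      using of_nat_mono[OF n(1), where ?'a = real] of_nat_mono[OF less_imp_le[OF n(2)], where ?'a = real]
      by simp_all
    have n1: "1 \<le> n"
      using order_trans[OF one_le_power n(1)] by simp
    have weight: "real n powr s \<le> K * (w (Suc m) / 2 ^ Suc m)"
    proof -
      have w_eq: "w (Suc m) / 2 ^ Suc m = (2 ^ Suc m) powr s"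
      proof -
        have "2 powr s = c powr p / 2 / 2"
          by (simp add: s_def c_def powr_powr powr_diff)
        then have "(2 powr s) ^ Suc m = w (Suc m) / 2 ^ Suc m"
          by (simp only: w_def power_divide)
        then show ?thesis
          using powr_power_commute[of 2 s "Suc m"] by (simp only: zero_less_numeral)
      qed
      show ?thesis
      proof (cases "0 \<le> s")
        case True
        then have "real n powr s \<le> 1 * (2 ^ Suc m) powr s"
          using n_real by (simp add: powr_mono2)
        also have "\<dots> \<le> K * (2 ^ Suc m) powr s"
          by (intro mult_right_mono) (auto simp: K_def)
        finally show ?thesis by (simp only: w_eq)
      next
        case False
        then have "real n powr s \<le> (2 ^ m) powr s"
          using n_real by (intro powr_mono2') auto
        also have "\<dots> = 2 powr (- s) * (2 ^ Suc m) powr s"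
          by (simp add: powr_mult powr_minus)
        also have "\<dots> \<le> K * (2 ^ Suc m) powr s"
          by (intro mult_right_mono) (auto simp: K_def)
        finally show ?thesis by (simp only: w_eq)
      qed
    qed
    have tail: "prob {\<omega> \<in> space M. \<epsilon> * real n powr (1 / r) < max_partial_sum X n \<omega>}
        \<le> R X (Suc m) + R (\<lambda>i \<omega>. - X i \<omega>) (Suc m)"
    proof -
      let ?A = "\<lambda>Z. {\<omega>\<in>space M. \<eta> * c ^ Suc m < S Z (Suc m) \<omega>}"
      have meas: "?A Z \<in> sets M" if "\<And>i. 1 \<le> i \<Longrightarrow> Z i \<in> borel_measurable M" for Z
        using that unfolding S_def by measurable
      have lower: "2 * (\<eta> * c ^ Suc m) \<le> \<epsilon> * real n powr (1 / r)"
      proof -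
        have "2 * (\<eta> * c ^ Suc m) = \<epsilon> * (2 ^ m) powr (1 / r)"
          using c by (simp add: \<eta>_def flip: c_power)
        also have "\<dots> \<le> \<epsilon> * real n powr (1 / r)"
          using assms(6,12) n_real by (intro mult_left_mono powr_mono2) auto
        finally show ?thesis .
      qed
      have "max_partial_sum X n \<omega> \<le> S X (Suc m) \<omega> + S (\<lambda>i \<omega>. - X i \<omega>) (Suc m) \<omega>" for \<omega>
        unfolding S_def using n n1 by (intro max_partial_sum_le) auto
      then have "{\<omega> \<in> space M. \<epsilon> * real n powr (1 / r) < max_partial_sum X n \<omega>} \<subseteq>
          ?A X \<union> ?A (\<lambda>i \<omega>. - X i \<omega>)"
        using lower by (smt (verit) Un_iff mem_Collect_eq subsetI)
      then have "prob {\<omega> \<in> space M. \<epsilon> * real n powr (1 / r) < max_partial_sum X n \<omega>}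
          \<le> prob (?A X \<union> ?A (\<lambda>i \<omega>. - X i \<omega>))"
        using assms(2) by (intro finite_measure_mono sets.Un meas) auto
      also have "\<dots> \<le> prob (?A X) + prob (?A (\<lambda>i \<omega>. - X i \<omega>))"
        using assms(2) by (intro measure_Un_le meas) auto
      finally show ?thesis
        by (simp add: R_def)
    qed
    have "real n powr s * prob {\<omega> \<in> space M. \<epsilon> * real n powr (1 / r) < max_partial_sum X n \<omega>}
        \<le> K * (w (Suc m) / 2 ^ Suc m) * (R X (Suc m) + R (\<lambda>i \<omega>. - X i \<omega>) (Suc m))"
      by (rule mult_mono[OF weight tail order_trans[OF powr_ge_zero weight] measure_nonneg])
    then show "real n powr (p / r - 2) * prob {\<omega> \<in> space M. \<epsilon> * real n powr (1 / r) < max_partial_sum X n \<omega>}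
        \<le> K / 2 * (w (Suc m) * R X (Suc m) + w (Suc m) * R (\<lambda>i \<omega>. - X i \<omega>) (Suc m)) / 2 ^ m"
      by (simp add: s_def algebra_simps add_divide_distrib)
  qed simp
qed

end
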